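(* Consider a normalized Hamburger moment problem with orthonormal polynomials $P_n$, polynomials of the second kind $Q_n$ and recurrence coefficients $a_n\in\mathbb R$, $b_n>0$. Assume that $$\sum_{n=1}^\infty\frac{1+|a_n|}{b_{n-1}}<\infty,$$ and that there is $n_0\ge1$ such that either $b_n^2\le b_{n-1}b_{n+1}$ for all $n\ge n_0$, or $b_n^2\ge b_{n-1}b_{n+1}$ for all $n\ge n_0$. Assume in addition that the function $P$ satisfies $$P(z)\le C\exp(K|z|^\alpha),\quad z\in\mathbb C,$$ for some $\alpha$ with $0<\alpha<1$ and suitable constants $C,K>0$. Then, as $n\to\infty$, $$1/b_n,\ P_n^2(0),\ Q_n^2(0)=O(n^{-1/\alpha}),$$ so in particular $(1/b_n),(P_n^2(0)),(Q_n^2(0))\in\ell^{\alpha+\varepsilon}$ for any $\varepsilon>0$.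
   Context: A normalized Hamburger moment problem is given by a sequence $s_n=\int_{-\infty}^\infty x^n\,d\mu(x)$, $n\ge0$, where $\mu$ is a probability measure on $\mathbb R$ with infinite support and moments of every order. Let $P_n$ be the orthonormal polynomials (positive leading coefficients) and $Q_n$ the polynomials of the second kind. Both are solutions of $$z r_n(z)=b_nr_{n+1}(z)+a_nr_n(z)+b_{n-1}r_{n-1}(z),\quad n\ge0,$$ with $a_n\in\mathbb R$, $b_n>0$ for $n\ge 0$, $b_{-1}=1$, and initial conditions $P_0=1$, $P_{-1}=0$, $Q_0=0$, $Q_{-1}=-1$. Put $P(z)=(\sum_{n\ge0}|P_n(z)|^2)^{1/2}$. For $\alpha>0$, $\ell^\alpha=\{(x_n)\mid \sum_{n}|x_n|^\alpha<\infty\}$. *)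

theory Defs
  imports "HOL-Probability.Probability" "HOL-Computational_Algebra.Polynomial"
    "HOL-Library.Landau_Symbols"
begin

definition measure_support :: "real measure \<Rightarrow> real set" where
  "measure_support M = {x. \<forall>U. open U \<and> x \<in> U \<longrightarrow> emeasure M U > 0}"

definition normalized_hamburger :: "(nat \<Rightarrow> real) \<Rightarrow> real measure \<Rightarrow> bool" where
  "normalized_hamburger s M \<longleftrightarrow>
     real_distribution M \<and> infinite (measure_support M) \<and>
     (\<forall>n. integrable M (\<lambda>x. x ^ n) \<and> s n = (\<integral>x. x ^ n \<partial>M))"

definition orthonormal_polys :: "real measure \<Rightarrow> (nat \<Rightarrow> real poly) \<Rightarrow> bool" where
  "orthonormal_polys M P \<longleftrightarrow>
     (\<forall>n. degree (P n) = n \<and> lead_coeff (P n) > 0) \<and>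
     (\<forall>m n. (\<integral>x. poly (P m) x * poly (P n) x \<partial>M) = (if m = n then 1 else 0))"

definition cpoly :: "real poly \<Rightarrow> complex \<Rightarrow> complex" where
  "cpoly p z = poly (map_poly complex_of_real p) z"

text \<open>The argument \<open>c\<close> is the value of the solution at index \<open>-1\<close>; since \<open>b\<close> is indexed by the
  natural numbers, the convention that \<open>b\<close> is \<open>1\<close> at index \<open>-1\<close> is built into the case \<open>n = 0\<close>.\<close>

definition recurrence_solution ::
    "(nat \<Rightarrow> real) \<Rightarrow> (nat \<Rightarrow> real) \<Rightarrow> real \<Rightarrow> (nat \<Rightarrow> real poly) \<Rightarrow> bool" where
  "recurrence_solution a b c r \<longleftrightarrow>
     (\<forall>n z. z * cpoly (r n) z =
        of_real (b n) * cpoly (r (n + 1)) z + of_real (a n) * cpoly (r n) z +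
        (if n = 0 then 1 * of_real c else of_real (b (n - 1)) * cpoly (r (n - 1)) z))"

text \<open>The recurrence coefficients of \<open>P\<close> are determined by \<open>P\<close>, as the coefficients of the
  recurrence which \<open>P\<close> satisfies with initial values \<open>0, 1\<close>.\<close>

definition recurrence_coeffs ::
    "(nat \<Rightarrow> real poly) \<Rightarrow> (nat \<Rightarrow> real) \<Rightarrow> (nat \<Rightarrow> real) \<Rightarrow> bool" where
  "recurrence_coeffs P a b \<longleftrightarrow> (\<forall>n. b n > 0) \<and> P 0 = 1 \<and> recurrence_solution a b 0 P"

definition second_kind_polys ::
    "(nat \<Rightarrow> real) \<Rightarrow> (nat \<Rightarrow> real) \<Rightarrow> (nat \<Rightarrow> real poly) \<Rightarrow> bool" where
  "second_kind_polys a b Q \<longleftrightarrow> Q 0 = 0 \<and> recurrence_solution a b (-1) Q"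

text \<open>Extended-real valued: the series may diverge (it does off the real axis if the moment problem is
  determinate), and then an upper bound on it has to fail.\<close>

definition P_fun :: "(nat \<Rightarrow> real poly) \<Rightarrow> complex \<Rightarrow> ereal" where
  "P_fun P z =
     (if summable (\<lambda>n. (cmod (cpoly (P n) z))\<^sup>2)
      then ereal (sqrt (\<Sum>n. (cmod (cpoly (P n) z))\<^sup>2)) else \<infinity>)"

definition ell :: "real \<Rightarrow> (nat \<Rightarrow> real) set" where
  "ell p = {x. summable (\<lambda>n. \<bar>x n\<bar> powr p)}"

end

theory Submission imports Defs "HOL-Complex_Analysis.Cauchy_Integral_Formula"
begin

text \<open>The leading coefficient of \<open>P\<^sub>n\<close> is \<open>1 / (b\<^sub>0 \<cdots> b\<^sub>n\<^sub>-\<^sub>1)\<close>, so Cauchy's inequality on the circle of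
  radius \<open>n\<^bsup>1/\<alpha>\<^esup>\<close> and the growth bound on the function \<open>P\<close> give \<open>b\<^sub>0 \<cdots> b\<^sub>n\<^sub>-\<^sub>1 \<ge> c\<^sup>n n\<^bsup>n/\<alpha>\<^esup>\<close> with
  some \<open>c > 0\<close>. Since \<open>b\<^sub>n \<rightarrow> \<infinity>\<close>, either convexity hypothesis makes \<open>b\<close> eventually
  increasing, whence \<open>1 / b\<^sub>n = O(n\<^bsup>-1/\<alpha>\<^esup>)\<close>. For the values \<open>r\<^sub>n\<close> at \<open>0\<close> of a solution, put
  \<open>v\<^sub>n = \<surd>b\<^sub>n r\<^sub>n\<^sub>+\<^sub>1\<close> if \<open>b\<close> is log-convex and \<open>v\<^sub>n = \<surd>b\<^sub>n r\<^sub>n\<close> if \<open>b\<close> is log-concave. The recurrence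
  becomes \<open>\<bar>v\<^sub>n\<^sub>+\<^sub>2\<bar> \<le> e\<^sub>n \<bar>v\<^sub>n\<^sub>+\<^sub>1\<bar> + \<bar>v\<^sub>n\<bar>\<close> with summable \<open>e\<close>, so \<open>v\<close> is bounded.\<close>

section \<open>Cauchy estimate for the coefficients of a polynomial\<close>

lemma higher_deriv_poly:
  fixes p :: "'a :: real_normed_field poly"
  shows "(deriv ^^ n) (poly p) = poly ((pderiv ^^ n) p)"
proof (induction n)
  case (Suc n)
  then show ?case by (auto intro!: ext DERIV_imp_deriv poly_DERIV)
qed simp

text \<open>Cauchy's inequality bounds the \<open>n\<close>-th derivative at 0, which for a
  polynomial is \<open>fact n\<close> times its \<open>n\<close>-th coefficient; the factorials
  cancel.\<close>

lemma cmod_coeff_le: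
  fixes p :: "complex poly"
  assumes "0 < r" and "\<And>z. cmod z = r \<Longrightarrow> cmod (poly p z) \<le> B"
  shows "cmod (coeff p n) \<le> B / r ^ n"
proof -
  have "cmod ((deriv ^^ n) (poly p) 0) \<le> fact n * B / r ^ n"
    by (rule Cauchy_inequality) (use assms in \<open>auto intro!: holomorphic_intros continuous_intros\<close>)
  moreover have "(deriv ^^ n) (poly p) 0 = fact n * coeff p n"
    by (simp add: higher_deriv_poly poly_0_coeff_0 coeff_higher_pderiv pochhammer_fact)
  ultimately have "fact n * cmod (coeff p n) \<le> fact n * (B / r ^ n)"
    by (simp add: norm_mult)
  then show ?thesis
    by (simp only: mult_le_cancel_left_pos[OF fact_gt_zero])
qed

section \<open>Coefficients and values at 0 of the recurrence\<close>

lemma cpoly_of_real: "cpoly p (of_real x) = of_real (poly p x)"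
  by (induction p) (simp_all add: cpoly_def map_poly_pCons)

text \<open>On real arguments the complex recurrence is an equation between real polynomial
  functions, and such functions determine their polynomials. In this form coefficients can be
  compared.\<close>

lemma recurrence_solution_poly:
  assumes "recurrence_solution a b c r"
  shows "pCons 0 (r n) = smult (b n) (r (n + 1)) + smult (a n) (r n) +
    (if n = 0 then [:c:] else smult (b (n - 1)) (r (n - 1)))"
proof -
  have "x * poly (r n) x = b n * poly (r (n + 1)) x + a n * poly (r n) x +
    (if n = 0 then c else b (n - 1) * poly (r (n - 1)) x)" for x
  proof -
    have "of_real x * cpoly (r n) (of_real x) =
        of_real (b n) * cpoly (r (n + 1)) (of_real x) + of_real (a n) * cpoly (r n) (of_real x) +
        (if n = 0 then 1 * of_real c else of_real (b (n - 1)) * cpoly (r (n - 1)) (of_real x))"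
      using assms unfolding recurrence_solution_def by blast
    then have "complex_of_real (x * poly (r n) x) = of_real (b n * poly (r (n + 1)) x +
        a n * poly (r n) x + (if n = 0 then c else b (n - 1) * poly (r (n - 1)) x))"
      by (simp add: cpoly_of_real split: if_splits)
    then show ?thesis
      using of_real_eq_iff by blast
  qed
  then show ?thesis
    by (intro iffD1[OF poly_eq_poly_eq_iff] ext) simp
qed

text \<open>Starting at index \<open>Suc n\<close> stays clear of the initial value
  \<open>c\<close>, so \<open>P\<close> and \<open>Q\<close> obey one and the same scalar recurrence
  at 0.\<close>

lemma recurrence_solution_0:
  assumes "recurrence_solution a b c r"
  shows "b (Suc n) * poly (r (Suc (Suc n))) 0 =
    - (a (Suc n) * poly (r (Suc n)) 0) - b n * poly (r n) 0"
proof -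
  have "poly (pCons 0 (r (Suc n))) 0 = poly (smult (b (Suc n)) (r (Suc n + 1)) +
      smult (a (Suc n)) (r (Suc n)) + smult (b n) (r n)) 0"
    using recurrence_solution_poly[OF assms, of "Suc n"] by simp
  then show ?thesis by simp
qed

text \<open>Compare coefficients of degree \<open>Suc n\<close> in the recurrence: for degree
  reasons only the shifted \<open>P n\<close> and \<open>b n\<close> times \<open>P (Suc n)\<close>
  contribute, so each step divides the leading coefficient by \<open>b n\<close>.\<close>

lemma lead_coeff_times_prod:
  assumes "recurrence_coeffs P a b" and deg: "\<And>n. degree (P n) = n"
  shows "lead_coeff (P n) * (\<Prod>k<n. b k) = 1"
proof (induction n)
  case 0
  then show ?case using assms(1) by (simp add: recurrence_coeffs_def)
next
  case (Suc n)
  have rec: "recurrence_solution a b 0 P"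
    using assms(1) by (simp add: recurrence_coeffs_def)
  have "coeff (P n) (Suc n) = 0" "coeff (P (n - 1)) (Suc n) = 0"
    by (simp_all add: coeff_eq_0 deg)
  then have "coeff (P n) n = b n * coeff (P (Suc n)) (Suc n)"
    using arg_cong[OF recurrence_solution_poly[OF rec, of n], of "\<lambda>p. coeff p (Suc n)"]
    by (simp split: if_splits)
  then show ?case
    using Suc.IH by (simp add: deg mult_ac)
qed

section \<open>From the growth of the function P to the leading coefficients\<close>

text \<open>A real upper bound rules out the value \<open>\<infinity>\<close>, so the series
  converges and dominates each of its nonnegative terms.\<close>

lemma cmod_cpoly_le:
  assumes "P_fun P z \<le> ereal B"
  shows "cmod (cpoly (P n) z) \<le> B"
proof -
  let ?f = "\<lambda>n. (cmod (cpoly (P n) z))\<^sup>2"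
  have f: "summable ?f" "sqrt (suminf ?f) \<le> B"
    using assms by (auto simp: P_fun_def split: if_splits)
  have "?f n \<le> suminf ?f"
    using sum_le_suminf[OF f(1), of "{n}"] by simp
  then have "cmod (cpoly (P n) z) \<le> sqrt (suminf ?f)"
    by (rule real_le_rsqrt)
  then show ?thesis
    using f(2) by simp
qed

text \<open>The coefficient estimate on the circle of radius \<open>r\<close>. The radius stays free
  so that it can later be chosen depending on \<open>n\<close>.\<close>

lemma lead_coeff_le:
  assumes "\<And>z. P_fun P z \<le> ereal (C * exp (K * cmod z powr \<alpha>))"
    and "degree (P n) = n" and "0 < r"
  shows "lead_coeff (P n) \<le> C * exp (K * r powr \<alpha>) / r ^ n"
proof -
  have "cmod (coeff (map_poly complex_of_real (P n)) n) \<le> C * exp (K * r powr \<alpha>) / r ^ n"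
    using cmod_cpoly_le[OF assms(1)] \<open>0 < r\<close>
    by (intro cmod_coeff_le) (auto simp: cpoly_def)
  then show ?thesis
    using assms(2) by (simp add: coeff_map_poly)
qed

section \<open>Monotonicity of b\<close>

text \<open>Otherwise \<open>b\<close> would be nonincreasing from \<open>m\<close> on, and
  \<open>1 / b n\<close> would stay above the positive number \<open>1 / b m\<close>.\<close>

lemma ex_increase_of_inverse_tendsto_0:
  fixes b :: "nat \<Rightarrow> real"
  assumes "(\<lambda>n. 1 / b n) \<longlonglongrightarrow> 0" and "\<And>n. 0 < b n"
  shows "\<exists>n\<ge>m. b n < b (Suc n)"
proof (rule ccontr)
  assume "\<not> ?thesis"
  then have step: "b (Suc n) \<le> b n" if "n \<ge> m" for n
    using that by force
  have "b n \<le> b m" if "n \<ge> m" for n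
    using that by (induction n rule: dec_induct) (auto intro: order_trans step)
  then have "1 / b m \<le> 1 / b n" if "n \<ge> m" for n
    using that assms(2) by (simp add: frac_le)
  then have "1 / b m \<le> 0"
    using assms(1) by (intro LIMSEQ_le_const) auto
  then show False
    using assms(2)[of m] by simp
qed

lemma log_convex_ratio_step:
  fixes x y z :: real
  assumes "0 < x" "x \<le> y" "y\<^sup>2 \<le> x * z"
  shows "y \<le> z"
proof -
  have "x * y \<le> y * y" using assms by (intro mult_right_mono) auto
  then have "x * y \<le> x * z" using assms(3) by (simp add: power2_eq_square)
  then show ?thesis using assms(1) by simp
qed

text \<open>Log-convexity makes the ratios \<open>b (Suc n) / b n\<close> nondecreasing, so once a
  ratio exceeds 1, all later ones do; a first such index exists because \<open>1 / b n\<close> tends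
  to 0.\<close>

lemma eventually_increasing_log_convex:
  fixes b :: "nat \<Rightarrow> real"
  assumes lim: "(\<lambda>n. 1 / b n) \<longlonglongrightarrow> 0" and pos: "\<And>n. 0 < b n"
    and conv: "\<And>n. n \<ge> m \<Longrightarrow> (b (Suc n))\<^sup>2 \<le> b n * b (Suc (Suc n))"
  shows "\<forall>\<^sub>F n in sequentially. b n \<le> b (Suc n)"
proof -
  obtain k where k: "k \<ge> m" "b k < b (Suc k)"
    using ex_increase_of_inverse_tendsto_0[OF lim pos] by blast
  have "b n \<le> b (Suc n)" if "n \<ge> k" for n
    using that
  proof (induction n rule: dec_induct)
    case base
    then show ?case using k by simp
  next
    case (step n)
    then show ?case
      using log_convex_ratio_step[OF pos step.IH conv] k by simp
  qed
  then show ?thesis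
    by (auto simp: eventually_sequentially)
qed

text \<open>Here the ratios are nonincreasing, so a single decrease would make \<open>b\<close>
  nonincreasing forever after. Hence monotonicity holds from \<open>m\<close> itself and not just
  eventually.\<close>

lemma increasing_log_concave:
  fixes b :: "nat \<Rightarrow> real"
  assumes lim: "(\<lambda>n. 1 / b n) \<longlonglongrightarrow> 0" and pos: "\<And>n. 0 < b n"
    and conc: "\<And>n. n \<ge> m \<Longrightarrow> (b (Suc n))\<^sup>2 \<ge> b n * b (Suc (Suc n))"
    and "n \<ge> m"
  shows "b n \<le> b (Suc n)"
proof (rule ccontr)
  assume less: "\<not> b n \<le> b (Suc n)"
  have "b (Suc k) \<le> b k" if "k \<ge> n" for k
    using that
  proof (induction k rule: dec_induct)
    case base
    then show ?case using less by simp
  next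
    case (step k)
    have "b k * b (Suc (Suc k)) \<le> b (Suc k) * b (Suc k)"
      using conc[of k] step \<open>n \<ge> m\<close> by (simp add: power2_eq_square)
    also have "\<dots> \<le> b k * b (Suc k)"
      using step.IH pos[of "Suc k"] by (intro mult_right_mono) auto
    finally show ?case using pos[of k] by simp
  qed
  then show False
    using ex_increase_of_inverse_tendsto_0[OF lim pos, of n] by force
qed

section \<open>Boundedness of rescaled solutions of the recurrence at 0\<close>

text \<open>A discrete Gronwall argument: the maximum of two consecutive absolute values grows by a
  factor of at most \<open>1 + e n \<le> exp (e n)\<close>, and the product of these factors is
  bounded by the exponential of the sum of \<open>e\<close>.\<close>

lemma bounded_perturbed_two_step:
  fixes v e :: "nat \<Rightarrow> real"
  assumes "summable e" and e: "\<And>n. 0 \<le> e n"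
    and step: "\<And>n. n \<ge> m \<Longrightarrow> \<bar>v (Suc (Suc n))\<bar> \<le> e n * \<bar>v (Suc n)\<bar> + \<bar>v n\<bar>"
  shows "\<exists>B\<ge>0. \<forall>n\<ge>m. \<bar>v n\<bar> \<le> B"
proof -
  define M where "M n = max \<bar>v n\<bar> \<bar>v (Suc n)\<bar>" for n
  have M: "M (Suc n) \<le> (1 + e n) * M n" if "n \<ge> m" for n
  proof -
    have "e n * \<bar>v (Suc n)\<bar> \<le> e n * M n"
      using e by (intro mult_left_mono) (auto simp: M_def)
    moreover have "\<bar>v n\<bar> \<le> M n" "\<bar>v (Suc n)\<bar> \<le> M n"
      by (auto simp: M_def)
    moreover have "0 \<le> e n * M n"
      using e by (intro mult_nonneg_nonneg) (auto simp: M_def)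
    ultimately show ?thesis
      using step[OF that] by (auto simp: M_def[of "Suc n"] algebra_simps)
  qed
  have bound: "M n \<le> M m * exp (\<Sum>k<n. e k)" if "n \<ge> m" for n
    using that
  proof (induction n rule: dec_induct)
    case base
    \<comment> \<open>The sum in the exponent starts at 0 rather than at \<open>m\<close>; the extra
      terms are nonnegative and only weaken the bound.\<close>
    have "M m * 1 \<le> M m * exp (\<Sum>k<m. e k)"
      using e by (intro mult_left_mono) (auto simp: M_def intro: sum_nonneg)
    then show ?case by simp
  next
    case (step n)
    have "M (Suc n) \<le> (1 + e n) * M n"
      using M step by simp
    also have "\<dots> \<le> exp (e n) * (M m * exp (\<Sum>k<n. e k))"
      using step.IH e by (intro mult_mono) (auto simp: M_def)
    finally show ?case by (simp add: exp_add mult_ac)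
  qed
  have "\<bar>v n\<bar> \<le> M m * exp (suminf e)" if "n \<ge> m" for n
  proof -
    have "\<bar>v n\<bar> \<le> M n" by (simp add: M_def)
    also note bound[OF that]
    also have "M m * exp (\<Sum>k<n. e k) \<le> M m * exp (suminf e)"
      using e \<open>summable e\<close> by (intro mult_left_mono) (auto simp: M_def intro: sum_le_suminf)
    finally show ?thesis .
  qed
  moreover have "0 \<le> M m * exp (suminf e)"
    by (simp add: M_def)
  ultimately show ?thesis by blast
qed

text \<open>Dividing the recurrence by \<open>sqrt (b (Suc (Suc n)))\<close> leaves the coefficient
  \<open>b (Suc n) / sqrt (b (Suc (Suc n)))\<close> at \<open>r (Suc n)\<close>. By log-convexity it
  is at most \<open>sqrt (b n)\<close>, which dictates the index shift in \<open>v\<close>.\<close>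

lemma log_convex_recurrence_bound:
  fixes a b r :: "nat \<Rightarrow> real"
  assumes pos: "\<And>n. 0 < b n" and sum: "summable (\<lambda>n. \<bar>a (Suc n)\<bar> / b n)"
    and conv: "\<And>n. n \<ge> m \<Longrightarrow> (b (Suc n))\<^sup>2 \<le> b n * b (Suc (Suc n))"
    and incr: "\<And>n. n \<ge> m \<Longrightarrow> b n \<le> b (Suc n)"
    and rec: "\<And>n. b (Suc n) * r (Suc (Suc n)) = - (a (Suc n) * r (Suc n)) - b n * r n"
  shows "\<exists>B\<ge>0. \<forall>n\<ge>m. (r (Suc n))\<^sup>2 \<le> B / b n"
proof -
  define v where "v n = sqrt (b n) * r (Suc n)" for n
  have "\<bar>v (Suc (Suc n))\<bar> \<le> \<bar>a (Suc (Suc n))\<bar> / b (Suc n) * \<bar>v (Suc n)\<bar> + \<bar>v n\<bar>" if "n \<ge> m" for n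
  proof -
    define x y z where "x = sqrt (b n)" and "y = sqrt (b (Suc n))" and "z = sqrt (b (Suc (Suc n)))"
    have xyz: "0 < x" "0 < y" "0 < z" and sq: "x\<^sup>2 = b n" "y\<^sup>2 = b (Suc n)" "z\<^sup>2 = b (Suc (Suc n))"
      using pos by (simp_all add: x_def y_def z_def less_imp_le)
    have "y \<le> z"
      using incr that by (simp add: y_def z_def)
    have "y\<^sup>2 \<le> x * z"
      using real_sqrt_le_mono[OF conv[OF that]] pos[of "Suc n"]
      by (simp add: x_def y_def z_def real_sqrt_mult)
    define A r1 r2 r3 where "A = a (Suc (Suc n))" and "r1 = r (Suc n)" and "r2 = r (Suc (Suc n))"
      and "r3 = r (Suc (Suc (Suc n)))"
    have "z\<^sup>2 * r3 = - (A * r2) - y\<^sup>2 * r1"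
      using rec[of "Suc n"] by (simp add: sq A_def r1_def r2_def r3_def)
    then have "\<bar>z\<^sup>2 * r3\<bar> \<le> \<bar>A * r2\<bar> + \<bar>y\<^sup>2 * r1\<bar>"
      by linarith
    then have "z\<^sup>2 * \<bar>r3\<bar> \<le> \<bar>A\<bar> * \<bar>r2\<bar> + y\<^sup>2 * \<bar>r1\<bar>"
      by (simp add: abs_mult)
    \<comment> \<open>The first summand uses \<open>z / y \<ge> 1\<close>, the second the square
      root of log-convexity. Both then carry the factor \<open>z\<close>, which cancels.\<close>
    also have "\<dots> \<le> z * (\<bar>A\<bar> / y\<^sup>2 * (y * \<bar>r2\<bar>) + x * \<bar>r1\<bar>)"
    proof -
      have "\<bar>A\<bar> * \<bar>r2\<bar> * 1 \<le> \<bar>A\<bar> * \<bar>r2\<bar> * (z / y)"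
        using \<open>y \<le> z\<close> xyz by (intro mult_left_mono) auto
      moreover have "y\<^sup>2 * \<bar>r1\<bar> \<le> x * z * \<bar>r1\<bar>"
        using \<open>y\<^sup>2 \<le> x * z\<close> by (intro mult_right_mono) auto
      ultimately show ?thesis
        using xyz by (simp add: algebra_simps power2_eq_square)
    qed
    finally have "z * (z * \<bar>r3\<bar>) \<le> z * (\<bar>A\<bar> / y\<^sup>2 * (y * \<bar>r2\<bar>) + x * \<bar>r1\<bar>)"
      by (simp add: power2_eq_square mult_ac)
    then have "z * \<bar>r3\<bar> \<le> \<bar>A\<bar> / y\<^sup>2 * (y * \<bar>r2\<bar>) + x * \<bar>r1\<bar>"
      using xyz by simp
    then show ?thesis
      using xyz by (simp add: v_def abs_mult sq A_def r1_def r2_def r3_def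
        flip: x_def y_def z_def)
  qed
  moreover have "summable (\<lambda>n. \<bar>a (Suc (Suc n))\<bar> / b (Suc n))"
    using summable_ignore_initial_segment[OF sum, of 1] by simp
  ultimately obtain B where B: "\<And>n. n \<ge> m \<Longrightarrow> \<bar>v n\<bar> \<le> B"
    using bounded_perturbed_two_step[of "\<lambda>n. \<bar>a (Suc (Suc n))\<bar> / b (Suc n)" m v] pos
    by (auto simp: less_imp_le)
  have "(r (Suc n))\<^sup>2 \<le> B\<^sup>2 / b n" if "n \<ge> m" for n
    using power_mono[OF B[OF that], of 2] pos[of n]
    by (simp add: v_def power_mult_distrib field_simps less_imp_le)
  then show ?thesis
    by (intro exI[of _ "B\<^sup>2"]) auto
qed

text \<open>Log-concavity reverses the inequality behind the log-convex bound, so the weight moves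
  to the same index: \<open>v n = sqrt (b n) * r n\<close>. The price is a ratio of consecutive
  square roots in the perturbation, bounded because the ratios of \<open>b\<close> are
  nonincreasing.\<close>

lemma log_concave_recurrence_bound:
  fixes a b r :: "nat \<Rightarrow> real"
  assumes pos: "\<And>n. 0 < b n" and sum: "summable (\<lambda>n. \<bar>a (Suc n)\<bar> / b n)"
    and conc: "\<And>n. n \<ge> m \<Longrightarrow> (b (Suc n))\<^sup>2 \<ge> b n * b (Suc (Suc n))"
    and incr: "\<And>n. n \<ge> m \<Longrightarrow> b n \<le> b (Suc n)"
    and rec: "\<And>n. b (Suc n) * r (Suc (Suc n)) = - (a (Suc n) * r (Suc n)) - b n * r n"
  shows "\<exists>B\<ge>0. \<forall>n\<ge>m. (r n)\<^sup>2 \<le> B / b n"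
proof -
  define L where "L = b (Suc m) / b m"
  have "0 < L" using pos by (simp add: L_def)
  \<comment> \<open>Ratios of a log-concave sequence do not increase, so the one at \<open>m\<close>
    bounds all later ones.\<close>
  have ratio: "b (Suc n) \<le> L * b n" if "n \<ge> m" for n
    using that
  proof (induction n rule: dec_induct)
    case base
    then show ?case using pos[of m] by (simp add: L_def)
  next
    case (step n)
    have "b n * b (Suc (Suc n)) \<le> b (Suc n) * b (Suc n)"
      using conc[of n] step by (simp add: power2_eq_square)
    also have "\<dots> \<le> (L * b n) * b (Suc n)"
      using step.IH pos[of "Suc n"] by (intro mult_right_mono) auto
    finally have "b n * b (Suc (Suc n)) \<le> b n * (L * b (Suc n))"
      by (simp add: mult_ac)
    then show ?case using pos[of n] by simp
  qed
  define v where "v n = sqrt (b n) * r n" for n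
  have "\<bar>v (Suc (Suc n))\<bar> \<le> sqrt L * (\<bar>a (Suc n)\<bar> / b n) * \<bar>v (Suc n)\<bar> + \<bar>v n\<bar>" if "n \<ge> m" for n
  proof -
    define x y z where "x = sqrt (b n)" and "y = sqrt (b (Suc n))" and "z = sqrt (b (Suc (Suc n)))"
    have xyz: "0 < x" "0 < y" "0 < z" and sq: "x\<^sup>2 = b n" "y\<^sup>2 = b (Suc n)" "z\<^sup>2 = b (Suc (Suc n))"
      using pos by (simp_all add: x_def y_def z_def less_imp_le)
    have "x \<le> y"
      using incr that by (simp add: x_def y_def)
    have "x * z \<le> y\<^sup>2"
      using real_sqrt_le_mono[OF conc[OF that]] pos[of "Suc n"]
      by (simp add: x_def y_def z_def real_sqrt_mult)
    have "z \<le> sqrt L * y"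
      using real_sqrt_le_mono[OF ratio[of "Suc n"]] that
      by (simp add: y_def z_def real_sqrt_mult)
    define A r1 r2 r3 where "A = a (Suc n)" and "r1 = r n" and "r2 = r (Suc n)"
      and "r3 = r (Suc (Suc n))"
    have "y\<^sup>2 * r3 = - (A * r2) - x\<^sup>2 * r1"
      using rec[of n] by (simp add: sq A_def r1_def r2_def r3_def)
    then have "\<bar>y\<^sup>2 * r3\<bar> \<le> \<bar>A * r2\<bar> + \<bar>x\<^sup>2 * r1\<bar>"
      by linarith
    then have "y\<^sup>2 * \<bar>r3\<bar> \<le> \<bar>A\<bar> * \<bar>r2\<bar> + x\<^sup>2 * \<bar>r1\<bar>"
      by (simp add: abs_mult)
    then have "z * (y\<^sup>2 * \<bar>r3\<bar>) \<le> z * (\<bar>A\<bar> * \<bar>r2\<bar> + x\<^sup>2 * \<bar>r1\<bar>)"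
      using xyz by (intro mult_left_mono) auto
    also have "\<dots> = z * (\<bar>A\<bar> * \<bar>r2\<bar>) + x * z * (x * \<bar>r1\<bar>)"
      by (simp add: algebra_simps power2_eq_square)
    \<comment> \<open>In the first summand \<open>z / y \<le> sqrt L\<close>, and the factor
      \<open>b (Suc n) / b n \<ge> 1\<close> brings \<open>b n\<close> into the denominator, as in
      the summability hypothesis. The second uses \<open>x * z\<close> against the square of
      \<open>y\<close>, which then cancels throughout.\<close>
    also have "\<dots> \<le> y\<^sup>2 * (sqrt L * (\<bar>A\<bar> / x\<^sup>2) * (y * \<bar>r2\<bar>)) + y\<^sup>2 * (x * \<bar>r1\<bar>)"
    proof (rule add_mono)
      have "x\<^sup>2 \<le> y\<^sup>2"
        using \<open>x \<le> y\<close> xyz by (simp add: power_mono)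
      then have "1 * (\<bar>A\<bar> * \<bar>r2\<bar>) \<le> (y\<^sup>2 / x\<^sup>2) * (\<bar>A\<bar> * \<bar>r2\<bar>)"
        using xyz by (intro mult_right_mono) auto
      then have "z * (\<bar>A\<bar> * \<bar>r2\<bar>) \<le> (sqrt L * y) * ((y\<^sup>2 / x\<^sup>2) * (\<bar>A\<bar> * \<bar>r2\<bar>))"
        using \<open>z \<le> sqrt L * y\<close> xyz \<open>0 < L\<close> by (intro mult_mono[of z]) auto
      then show "z * (\<bar>A\<bar> * \<bar>r2\<bar>) \<le> y\<^sup>2 * (sqrt L * (\<bar>A\<bar> / x\<^sup>2) * (y * \<bar>r2\<bar>))"
        by (simp add: mult_ac)
      show "x * z * (x * \<bar>r1\<bar>) \<le> y\<^sup>2 * (x * \<bar>r1\<bar>)"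
        using \<open>x * z \<le> y\<^sup>2\<close> xyz by (intro mult_right_mono) auto
    qed
    finally have "y\<^sup>2 * (z * \<bar>r3\<bar>) \<le> y\<^sup>2 * (sqrt L * (\<bar>A\<bar> / x\<^sup>2) * (y * \<bar>r2\<bar>) + x * \<bar>r1\<bar>)"
      by (simp add: algebra_simps)
    then have "z * \<bar>r3\<bar> \<le> sqrt L * (\<bar>A\<bar> / x\<^sup>2) * (y * \<bar>r2\<bar>) + x * \<bar>r1\<bar>"
      using xyz by simp
    then show ?thesis
      using xyz by (simp add: v_def abs_mult sq A_def r1_def r2_def r3_def
        flip: x_def y_def z_def)
  qed
  moreover have "summable (\<lambda>n. sqrt L * (\<bar>a (Suc n)\<bar> / b n))"
    using sum by (rule summable_mult)
  ultimately obtain B where B: "\<And>n. n \<ge> m \<Longrightarrow> \<bar>v n\<bar> \<le> B"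
    using bounded_perturbed_two_step[of "\<lambda>n. sqrt L * (\<bar>a (Suc n)\<bar> / b n)" m v] pos \<open>0 < L\<close>
    by (auto simp: less_imp_le)
  have "(r n)\<^sup>2 \<le> B\<^sup>2 / b n" if "n \<ge> m" for n
    using power_mono[OF B[OF that], of 2] pos[of n]
    by (simp add: v_def power_mult_distrib field_simps less_imp_le)
  then show ?thesis
    by (intro exI[of _ "B\<^sup>2"]) auto
qed

section \<open>Decay of the reciprocals of b\<close>

text \<open>Monotonicity bounds the product of the first \<open>Suc n\<close> terms by a power of a
  multiple of \<open>b n\<close>. For a suitable radius every factor of the estimate is bounded by a
  power with exponent \<open>Suc n\<close>, and taking roots isolates \<open>b n\<close>.\<close>

lemma inverse_bound_of_prod_bound:
  fixes b :: "nat \<Rightarrow> real"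
  assumes pos: "\<And>n. 0 < b n" and incr: "\<And>n. n \<ge> m \<Longrightarrow> b n \<le> b (Suc n)"
    and "0 < \<alpha>" "0 < C"
    and prod: "\<And>n r. 0 < r \<Longrightarrow> 1 / (\<Prod>k<n. b k) \<le> C * exp (K * r powr \<alpha>) / r ^ n"
  shows "\<exists>G>0. \<forall>n\<ge>m. 1 / b n \<le> G * real (Suc n) powr (- 1 / \<alpha>)"
proof -
  \<comment> \<open>The sum takes care of the finitely many terms up to \<open>m\<close>, where
    \<open>b\<close> need not be monotone; the summand 1 covers the later ones.\<close>
  define M where "M = 1 + (\<Sum>k\<le>m. b k / b m)"
  have "1 \<le> M"
    using pos by (simp add: M_def sum_nonneg less_imp_le)
  have mono: "b k \<le> b n" if "m \<le> k" "k \<le> n" for k n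
    using that(2,1) by (induction n rule: dec_induct) (auto intro: order_trans incr)
  have M: "b k \<le> M * b n" if "n \<ge> m" "k \<le> n" for k n
  proof (cases "k \<le> m")
    case True
    have "b k / b m \<le> (\<Sum>k\<le>m. b k / b m)"
      using True pos by (intro member_le_sum) (auto simp: less_imp_le)
    then have "b k \<le> M * b m"
      using pos[of m] by (simp add: M_def field_simps)
    also have "\<dots> \<le> M * b n"
      using \<open>1 \<le> M\<close> mono that by (intro mult_left_mono) auto
    finally show ?thesis .
  next
    case False
    then have "1 * b k \<le> M * b n"
      using \<open>1 \<le> M\<close> mono that pos[of k] by (intro mult_mono) (auto simp: less_imp_le)
    then show ?thesis by simp
  qed
  \<comment> \<open>Since \<open>D \<ge> 1\<close>, the constant \<open>C\<close> is absorbed into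
    \<open>D ^ N\<close> for every positive \<open>N\<close>.\<close>
  define D where "D = max C 1"
  have D: "1 \<le> D" "C \<le> D" by (auto simp: D_def)
  have "1 / b n \<le> M * D * exp K * real (Suc n) powr (- 1 / \<alpha>)" if "n \<ge> m" for n
  proof -
    define N where "N = Suc n"
    \<comment> \<open>With this radius \<open>r powr \<alpha>\<close> equals \<open>N\<close>, so
      the exponential becomes an \<open>N\<close>-th power.\<close>
    define r where "r = real N powr (1 / \<alpha>)"
    have "0 < r" by (simp add: r_def N_def)
    have "r powr \<alpha> = real N"
      using \<open>0 < \<alpha>\<close> by (simp add: r_def powr_powr)
    then have "1 / (\<Prod>k<N. b k) \<le> C * exp (K * real N) / r ^ N"
      using prod[OF \<open>0 < r\<close>, of N] by simp
    then have "r ^ N \<le> C * exp (K * real N) * (\<Prod>k<N. b k)"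
      using \<open>0 < r\<close> pos by (simp add: field_simps prod_pos)
    also have "\<dots> \<le> D ^ N * exp K ^ N * (M * b n) ^ N"
    proof (intro mult_mono)
      show "C \<le> D ^ N"
        using D self_le_power[of D N] unfolding N_def by linarith
      show "(\<Prod>k<N. b k) \<le> (M * b n) ^ N"
        using prod_mono[of "{..<N}" b "\<lambda>_. M * b n"] M[OF that] pos
        by (simp add: N_def less_imp_le less_Suc_eq_le)
    qed (use D \<open>0 < C\<close> pos in \<open>auto simp: prod_nonneg less_imp_le mult.commute simp flip: exp_of_nat_mult\<close>)
    also have "\<dots> = (D * exp K * (M * b n)) ^ N"
      by (simp add: power_mult_distrib)
    finally have "r \<le> D * exp K * (M * b n)"
      unfolding N_def by (rule power_le_imp_le_base) (use D \<open>1 \<le> M\<close> pos[of n] in simp)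
    then have "1 / b n \<le> M * D * exp K * (1 / r)"
      using \<open>0 < r\<close> pos[of n] by (simp add: field_simps)
    also have "1 / r = real (Suc n) powr (- 1 / \<alpha>)"
      by (simp add: r_def N_def powr_minus_divide)
    finally show ?thesis .
  qed
  moreover have "0 < M * D * exp K"
    using \<open>1 \<le> M\<close> D by simp
  ultimately show ?thesis by blast
qed

section \<open>Order bounds, summability and index shifts\<close>

text \<open>Raising the bound to the power \<open>p\<close> gives the exponent
  \<open>- p / \<alpha>\<close>, which is less than -1, so a convergent power series over
  \<open>n\<close> dominates.\<close>

lemma bigo_powr_imp_ell:
  assumes "x \<in> O(\<lambda>n. real n powr (- 1 / \<alpha>))" and "0 < \<alpha>" and "\<alpha> < p"
  shows "x \<in> ell p"
proof -
  obtain c where c: "c > 0" "\<forall>\<^sub>F n in sequentially. \<bar>x n\<bar> \<le> c * real n powr (- 1 / \<alpha>)"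
    using landau_o.bigE[OF assms(1)] by auto
  have "\<forall>\<^sub>F n in sequentially.
      norm (\<bar>x n\<bar> powr p) \<le> c powr p * norm (real n powr (- p / \<alpha>))"
    using c(2)
  proof eventually_elim
    case (elim n)
    have "\<bar>x n\<bar> powr p \<le> (c * real n powr (- 1 / \<alpha>)) powr p"
      using elim assms by (intro powr_mono2) auto
    also have "\<dots> = c powr p * real n powr (- p / \<alpha>)"
      using c(1) by (simp add: powr_mult powr_powr)
    finally show ?case by simp
  qed
  moreover have "summable (\<lambda>n. norm (real n powr (- p / \<alpha>)))"
    using assms by (simp add: summable_real_powr_iff field_simps)
  ultimately have "summable (\<lambda>n. \<bar>x n\<bar> powr p)"
    by (metis summable_comparison_test_bigo bigoI)
  then show ?thesis by (simp add: ell_def)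
qed

text \<open>Shaped for the application: the estimates bound the term at \<open>Suc n\<close> through
  \<open>1 / b n\<close>, which in turn is bounded by a power of \<open>Suc n\<close>.\<close>

lemma bigo_powr_Suc:
  fixes f :: "nat \<Rightarrow> real"
  assumes "\<forall>\<^sub>F n in sequentially. \<bar>f (Suc n)\<bar> \<le> c * real (Suc n) powr q"
  shows "f \<in> O(\<lambda>n. real n powr q)"
proof (rule bigoI)
  show "\<forall>\<^sub>F n in sequentially. norm (f n) \<le> c * norm (real n powr q)"
    using eventually_sequentially_Suc[of "\<lambda>n. norm (f n) \<le> c * norm (real n powr q)"] assms
    by simp
qed

section \<open>Combination of the estimates\<close>

theorem theorem1p4:
  fixes s :: "nat \<Rightarrow> real" and \<mu> :: "real measure"
    and P Q :: "nat \<Rightarrow> real poly" and a b :: "nat \<Rightarrow> real"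
    and \<alpha> C K :: real
  assumes "normalized_hamburger s \<mu>"
    and "orthonormal_polys \<mu> P"
    and "recurrence_coeffs P a b"
    and "second_kind_polys a b Q"
    and "summable (\<lambda>n. (1 + \<bar>a (n + 1)\<bar>) / b n)"
    and "\<exists>n0\<ge>1. (\<forall>n\<ge>n0. (b n)\<^sup>2 \<le> b (n - 1) * b (n + 1)) \<or>
                 (\<forall>n\<ge>n0. (b n)\<^sup>2 \<ge> b (n - 1) * b (n + 1))"
    and "0 < \<alpha>" and "\<alpha> < 1" and "C > 0" and "K > 0"
    and "\<And>z. P_fun P z \<le> ereal (C * exp (K * cmod z powr \<alpha>))"
  shows "((\<lambda>n. 1 / b n) \<in> O(\<lambda>n. real n powr (- 1 / \<alpha>)) \<and>
          (\<lambda>n. (poly (P n) 0)\<^sup>2) \<in> O(\<lambda>n. real n powr (- 1 / \<alpha>)) \<and>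
          (\<lambda>n. (poly (Q n) 0)\<^sup>2) \<in> O(\<lambda>n. real n powr (- 1 / \<alpha>))) \<and>
         (\<forall>\<epsilon>>0. (\<lambda>n. 1 / b n) \<in> ell (\<alpha> + \<epsilon>) \<and>
                 (\<lambda>n. (poly (P n) 0)\<^sup>2) \<in> ell (\<alpha> + \<epsilon>) \<and>
                 (\<lambda>n. (poly (Q n) 0)\<^sup>2) \<in> ell (\<alpha> + \<epsilon>))"
proof -
  have deg: "degree (P n) = n" for n
    using assms(2) by (auto simp: orthonormal_polys_def)
  have pos: "0 < b n" for n
    using assms(3) by (simp add: recurrence_coeffs_def)
  have sum: "summable (\<lambda>n. \<bar>a (Suc n)\<bar> / b n)" "summable (\<lambda>n. 1 / b n)"
    using assms(5) pos
    by (auto intro!: summable_comparison_test'[OF assms(5), of 0] simp: divide_right_mono less_imp_le)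
  have lim: "(\<lambda>n. 1 / b n) \<longlonglongrightarrow> 0"
    using sum(2) by (rule summable_LIMSEQ_zero)
  have P0: "b (Suc n) * poly (P (Suc (Suc n))) 0 =
      - (a (Suc n) * poly (P (Suc n)) 0) - b n * poly (P n) 0" for n
    using assms(3) recurrence_solution_0 by (auto simp: recurrence_coeffs_def)
  have Q0: "b (Suc n) * poly (Q (Suc (Suc n))) 0 =
      - (a (Suc n) * poly (Q (Suc n)) 0) - b n * poly (Q n) 0" for n
    using assms(4) recurrence_solution_0 by (auto simp: second_kind_polys_def)
  obtain n0 where n0: "n0 \<ge> 1" and "(\<forall>n\<ge>n0. (b n)\<^sup>2 \<le> b (n - 1) * b (n + 1)) \<or>
      (\<forall>n\<ge>n0. (b n)\<^sup>2 \<ge> b (n - 1) * b (n + 1))"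
    using assms(6) by blast
  \<comment> \<open>Reading the hypothesis at \<open>Suc n\<close> removes the truncated subtraction
    \<open>n - 1\<close>.\<close>
  then consider
      (conv) "\<And>n. n \<ge> n0 \<Longrightarrow> (b (Suc n))\<^sup>2 \<le> b n * b (Suc (Suc n))"
    | (conc) "\<And>n. n \<ge> n0 \<Longrightarrow> (b (Suc n))\<^sup>2 \<ge> b n * b (Suc (Suc n))"
    by (metis Suc_eq_plus1 diff_Suc_1 le_SucI)
  then obtain m where incr: "\<And>n. n \<ge> m \<Longrightarrow> b n \<le> b (Suc n)"
    and bound: "\<And>r. (\<And>n. b (Suc n) * r (Suc (Suc n)) = - (a (Suc n) * r (Suc n)) - b n * r n) \<Longrightarrow>
      \<exists>B\<ge>0. \<forall>\<^sub>F n in sequentially. (r (Suc n))\<^sup>2 \<le> B / b n"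
  proof cases
    case conv
    have "\<forall>\<^sub>F n in sequentially. b n \<le> b (Suc n)"
      using lim pos conv by (rule eventually_increasing_log_convex)
    then obtain m where m: "\<And>n. n \<ge> m \<Longrightarrow> b n \<le> b (Suc n)"
      unfolding eventually_sequentially by blast
    show ?thesis
    proof (rule that[of "max m n0"])
      fix r assume "\<And>n. b (Suc n) * r (Suc (Suc n)) = - (a (Suc n) * r (Suc n)) - b n * r n"
      then have "\<exists>B\<ge>0. \<forall>n\<ge>max m n0. (r (Suc n))\<^sup>2 \<le> B / b n"
        using m conv by (intro log_convex_recurrence_bound[OF pos sum(1)]) auto
      then show "\<exists>B\<ge>0. \<forall>\<^sub>F n in sequentially. (r (Suc n))\<^sup>2 \<le> B / b n"
        unfolding eventually_sequentially by blast
    qed (use m in auto)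
  next
    case conc
    have m: "b n \<le> b (Suc n)" if "n \<ge> n0" for n
      using lim pos conc that by (rule increasing_log_concave)
    show ?thesis
    proof (rule that[OF m])
      fix r assume "\<And>n. b (Suc n) * r (Suc (Suc n)) = - (a (Suc n) * r (Suc n)) - b n * r n"
      then have "\<exists>B\<ge>0. \<forall>n\<ge>n0. (r n)\<^sup>2 \<le> B / b n"
        using conc m by (intro log_concave_recurrence_bound[OF pos sum(1)]) auto
      then obtain B where B: "B \<ge> 0" "\<And>n. n \<ge> n0 \<Longrightarrow> (r n)\<^sup>2 \<le> B / b n"
        by blast
      \<comment> \<open>The log-concave bound is taken at \<open>Suc n\<close> and weakened by
        monotonicity, so that it has the form of the log-convex one.\<close>
      have "(r (Suc n))\<^sup>2 \<le> B / b n" if "n \<ge> n0" for n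
      proof -
        have "(r (Suc n))\<^sup>2 \<le> B / b (Suc n)"
          using B(2) that by simp
        also have "\<dots> \<le> B / b n"
          using B(1) m[OF that] pos by (intro divide_left_mono) auto
        finally show ?thesis .
      qed
      then show "\<exists>B\<ge>0. \<forall>\<^sub>F n in sequentially. (r (Suc n))\<^sup>2 \<le> B / b n"
        unfolding eventually_sequentially using B(1) by blast
    qed auto
  qed
  have prod: "1 / (\<Prod>k<n. b k) \<le> C * exp (K * r powr \<alpha>) / r ^ n" if "0 < r" for n r
  proof -
    have "1 / (\<Prod>k<n. b k) = lead_coeff (P n)"
      using lead_coeff_times_prod[OF assms(3) deg, of n] inverse_unique[of "\<Prod>k<n. b k"]
      by (simp add: inverse_eq_divide mult.commute)
    then show ?thesis
      using lead_coeff_le[OF assms(11) deg that] by simp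
  qed
  have "\<exists>G>0. \<forall>n\<ge>m. 1 / b n \<le> G * real (Suc n) powr (- 1 / \<alpha>)"
    using pos incr \<open>0 < \<alpha>\<close> \<open>C > 0\<close> prod by (rule inverse_bound_of_prod_bound)
  then obtain G where G: "\<And>n. n \<ge> m \<Longrightarrow> 1 / b n \<le> G * real (Suc n) powr (- 1 / \<alpha>)"
    by blast
  have bigo_b: "(\<lambda>n. 1 / b n) \<in> O(\<lambda>n. real n powr (- 1 / \<alpha>))"
  proof (rule bigo_powr_Suc)
    have "\<bar>1 / b (Suc n)\<bar> \<le> G * real (Suc n) powr (- 1 / \<alpha>)" if "n \<ge> m" for n
    proof -
      have "1 / b (Suc n) \<le> 1 / b n"
        using incr[OF that] pos by (simp add: frac_le)
      then show ?thesis
        using G[OF that] pos[of "Suc n"] by simp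
    qed
    then show "\<forall>\<^sub>F n in sequentially. \<bar>1 / b (Suc n)\<bar> \<le> G * real (Suc n) powr (- 1 / \<alpha>)"
      unfolding eventually_sequentially by blast
  qed
  have bigo_r: "(\<lambda>n. (r n)\<^sup>2) \<in> O(\<lambda>n. real n powr (- 1 / \<alpha>))"
    if rec: "\<And>n. b (Suc n) * r (Suc (Suc n)) = - (a (Suc n) * r (Suc n)) - b n * r n" for r
  proof -
    obtain B where B: "B \<ge> 0" "\<forall>\<^sub>F n in sequentially. (r (Suc n))\<^sup>2 \<le> B / b n"
      using bound[OF rec] by auto
    show ?thesis
    proof (rule bigo_powr_Suc)
      show "\<forall>\<^sub>F n in sequentially. \<bar>(r (Suc n))\<^sup>2\<bar> \<le> B * G * real (Suc n) powr (- 1 / \<alpha>)"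
        using B(2) eventually_ge_at_top[of m]
      proof eventually_elim
        case (elim n)
        then show ?case
          using mult_left_mono[OF G[OF elim(2)] B(1)] by simp
      qed
    qed
  qed
  \<comment> \<open>Both \<open>P\<close> and \<open>Q\<close> satisfy the scalar recurrence at 0,
    so one estimate serves for the two.\<close>
  note bigo = bigo_b bigo_r[of "\<lambda>n. poly (P n) 0", OF P0] bigo_r[of "\<lambda>n. poly (Q n) 0", OF Q0]
  show ?thesis
    using bigo bigo[THEN bigo_powr_imp_ell[OF _ \<open>0 < \<alpha>\<close>]] by simp
qed

end
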